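(* Let $M\ge 2$, let $\tau_1,\dots,\tau_k$ be the $k$ highest-priority tasks of an arbitrary-deadline sporadic task set scheduled by global fixed-priority preemptive scheduling on $M$ identical processors, and suppose that all jobs of $\tau_1,\dots,\tau_{k-1}$ always meet their deadlines. Suppose $D_k>T_k$ and let $b=\frac{D_k-T_k}{T_k}$. Task $\tau_k$ is schedulable if the following holds: (i) in the case $bU_k-\sum_{i=1}^{k-1}\frac{C_i-C_iU_i}{T_k}>0$: $$\sum_{i=1}^{k}U_i\le M-(M-1)U_{\delta,k}^{\max};$$ (ii) otherwise: $$\frac{C_k}{D_k}+\sum_{i=1}^{k-1}\left(\frac{C_i-C_iU_i}{D_k}+U_i\right)\le M-(M-1)U_{\delta,k}^{\max}.$$
   Context: Model. There are $M\ge2$ identical unit-speed processors. A sporadic task $\tau_i$ has worst-case execution time $C_i>0$, minimum inter-arrival time $T_i>0$, relative deadline $D_i>0$ and utilization $U_i=C_i/T_i$; it is assumed that $C_i\le D_i$ and $U_i\le1$, with no relation required between $D_i$ and $T_i$ (arbitrary deadlines). Task $\tau_i$ releases an infinite sequence of jobs whose consecutive arrivals are at least $T_i$ apart; each job needs at most $C_i$ units of execution, and a job arriving at $t$ must finish by its absolute deadline $t+D_i$. Preemption and migration cost nothing. At any instant at most one job of each task executes, on at most one processor; jobs of the same task are executed in arrival order. Global fixed-priority preemptive scheduling: tasks have unique fixed priorities, $\tau_i$ having higher priority than $\tau_j$ iff $i<j$; at each instant, among the tasks having an arrived and unfinished job, the $M$ highest-priority ones (all of them if fewer than $M$) execute.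 A task is schedulable if in every schedule so produced, for every legal arrival sequence, all its jobs meet their deadlines. Notation. Density $\delta_i=C_i/\min\{D_i,T_i\}$; $U_{\delta,k}^{\max}=\max\{\max_{1\le i\le k-1}U_i,\ \delta_k\}$. *)

theory Defs
  imports "HOL-Analysis.Analysis"
begin

text \<open>
  Tasks are numbered \<open>1, \<dots>, n\<close>, a smaller number meaning a higher priority; \<open>C\<close>, \<open>T\<close>, \<open>D\<close> give
  execution times, minimum inter-arrival times and relative deadlines. The jobs of task \<open>i\<close> are
  \<open>(i, 0), (i, 1), \<dots>\<close> in arrival order. Time is continuous and starts at \<open>0\<close>.
\<close>

definition utilization :: "(nat \<Rightarrow> real) \<Rightarrow> (nat \<Rightarrow> real) \<Rightarrow> nat \<Rightarrow> real" where
  "utilization C T i = C i / T i"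

definition density :: "(nat \<Rightarrow> real) \<Rightarrow> (nat \<Rightarrow> real) \<Rightarrow> (nat \<Rightarrow> real) \<Rightarrow> nat \<Rightarrow> real" where
  "density C T D i = C i / min (D i) (T i)"

text \<open>For \<open>k = 1\<close> there are no higher-priority tasks and the maximum is the density alone.\<close>

definition max_util_density ::
    "(nat \<Rightarrow> real) \<Rightarrow> (nat \<Rightarrow> real) \<Rightarrow> (nat \<Rightarrow> real) \<Rightarrow> nat \<Rightarrow> real" where
  "max_util_density C T D k = Max (insert (density C T D k) (utilization C T ` {1..<k}))"

definition sporadic_task_set ::
    "nat \<Rightarrow> (nat \<Rightarrow> real) \<Rightarrow> (nat \<Rightarrow> real) \<Rightarrow> (nat \<Rightarrow> real) \<Rightarrow> bool" where
  "sporadic_task_set n C T D \<longleftrightarrow>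
     (\<forall>i\<in>{1..n}. 0 < C i \<and> 0 < T i \<and> 0 < D i \<and> C i \<le> D i \<and> utilization C T i \<le> 1)"

text \<open>Job \<open>(i, j)\<close> arrives at time \<open>a i j\<close> and needs \<open>e i j\<close> units of execution.\<close>

definition legal_arrivals :: "nat \<Rightarrow> (nat \<Rightarrow> real) \<Rightarrow> (nat \<Rightarrow> nat \<Rightarrow> real) \<Rightarrow> bool" where
  "legal_arrivals n T a \<longleftrightarrow>
     (\<forall>i\<in>{1..n}. \<forall>j. 0 \<le> a i j \<and> a i j + T i \<le> a i (Suc j))"

definition legal_demands :: "nat \<Rightarrow> (nat \<Rightarrow> real) \<Rightarrow> (nat \<Rightarrow> nat \<Rightarrow> real) \<Rightarrow> bool" where
  "legal_demands n C e \<longleftrightarrow> (\<forall>i\<in>{1..n}. \<forall>j. 0 \<le> e i j \<and> e i j \<le> C i)"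

text \<open>Time and processor (numbered from \<open>0\<close>) to the job executed, if any.\<close>

type_synonym schedule = "real \<Rightarrow> nat \<Rightarrow> (nat \<times> nat) option"

definition executes :: "nat \<Rightarrow> schedule \<Rightarrow> nat \<Rightarrow> nat \<Rightarrow> real \<Rightarrow> bool" where
  "executes M \<sigma> i j t \<longleftrightarrow> (\<exists>p<M. \<sigma> t p = Some (i, j))"

text \<open>
  The execution received by a job before time \<open>t\<close>. As the processors have unit speed and a job
  never occupies two of them at once, this is the length of time during which it executes.
\<close>

definition service :: "nat \<Rightarrow> schedule \<Rightarrow> nat \<Rightarrow> nat \<Rightarrow> real \<Rightarrow> real" where
  "service M \<sigma> i j t = measure lebesgue {s. 0 \<le> s \<and> s < t \<and> executes M \<sigma> i j s}"

definition pending ::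
    "nat \<Rightarrow> (nat \<Rightarrow> nat \<Rightarrow> real) \<Rightarrow> (nat \<Rightarrow> nat \<Rightarrow> real) \<Rightarrow> schedule \<Rightarrow> nat \<Rightarrow> nat \<Rightarrow> real \<Rightarrow> bool" where
  "pending M a e \<sigma> i j t \<longleftrightarrow> a i j \<le> t \<and> service M \<sigma> i j t < e i j"

definition active_tasks ::
    "nat \<Rightarrow> nat \<Rightarrow> (nat \<Rightarrow> nat \<Rightarrow> real) \<Rightarrow> (nat \<Rightarrow> nat \<Rightarrow> real) \<Rightarrow> schedule \<Rightarrow> real \<Rightarrow> nat set" where
  "active_tasks M n a e \<sigma> t = {i \<in> {1..n}. \<exists>j. pending M a e \<sigma> i j t}"

text \<open>
  The measurability clause only makes \<open>service\<close> meaningful. The remaining clauses say: a task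
  occupies at most one processor; an executing job is the earliest unfinished job of its task; and
  the executing tasks are the \<open>M\<close> smallest-numbered active ones, or all if fewer are active.
\<close>

definition global_fp_schedule ::
    "nat \<Rightarrow> nat \<Rightarrow> (nat \<Rightarrow> nat \<Rightarrow> real) \<Rightarrow> (nat \<Rightarrow> nat \<Rightarrow> real) \<Rightarrow> schedule \<Rightarrow> bool" where
  "global_fp_schedule M n a e \<sigma> \<longleftrightarrow>
     (\<forall>i j. {t. 0 \<le> t \<and> executes M \<sigma> i j t} \<in> sets lebesgue) \<and>
     (\<forall>t\<ge>0.
        (\<forall>p<M. \<forall>q<M. \<forall>i j j'. \<sigma> t p = Some (i, j) \<and> \<sigma> t q = Some (i, j') \<longrightarrow> p = q) \<and>
        (\<forall>i j. executes M \<sigma> i j t \<longrightarrow>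
           pending M a e \<sigma> i j t \<and> (\<forall>j'<j. \<not> pending M a e \<sigma> i j' t)) \<and>
        {i. \<exists>j. executes M \<sigma> i j t} =
          {i \<in> active_tasks M n a e \<sigma> t. card {h \<in> active_tasks M n a e \<sigma> t. h < i} < M})"

definition schedulable ::
    "nat \<Rightarrow> nat \<Rightarrow> (nat \<Rightarrow> real) \<Rightarrow> (nat \<Rightarrow> real) \<Rightarrow> (nat \<Rightarrow> real) \<Rightarrow> nat \<Rightarrow> bool" where
  "schedulable M n C T D i \<longleftrightarrow>
     (\<forall>a e \<sigma>. legal_arrivals n T a \<and> legal_demands n C e \<and> global_fp_schedule M n a e \<sigma> \<longrightarrow>
        (\<forall>j. e i j \<le> service M \<sigma> i j (a i j + D i)))"

end

theory Submission
  imports Defs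
begin

text \<open>
  Let a job of \<open>\<tau>\<^sub>k\<close> miss its deadline \<open>d\<close>, and put \<open>\<mu> = M - (M - 1) \<rho>\<close> with
  \<open>\<rho>\<close> the maximum of the utilizations and of the density of \<open>\<tau>\<^sub>k\<close>. Whenever a task is active
  without executing, all \<open>M\<close> processors work for tasks of higher priority. Hence on the busy window
  of \<open>\<tau>\<^sub>k\<close> ending at \<open>d\<close> the tasks \<open>\<tau>\<^sub>1, \<dots>, \<tau>\<^sub>k\<close> receive service at an average rate of at least
  \<open>\<mu>\<close>. Push the left end of that window back to the earliest arrival \<open>t\<^sub>0\<close> for which the average
  rate on \<open>[t\<^sub>0, d)\<close> is still at least \<open>\<mu>\<close>. If a task \<open>i\<close> has been busy since \<open>u < t\<^sub>0\<close>, the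
  average rate on \<open>[u, t\<^sub>0)\<close> is below \<open>\<mu>\<close>, which forces \<open>i\<close> to execute there for more than
  \<open>\<rho> (t\<^sub>0 - u) \<ge> U\<^sub>i (t\<^sub>0 - u)\<close>; so carried-in work never hurts, and on \<open>[t\<^sub>0, d)\<close>, of length
  \<open>L \<ge> D\<^sub>k\<close>, task \<open>i < k\<close> executes for at most \<open>C\<^sub>i - C\<^sub>i U\<^sub>i + U\<^sub>i L\<close> and \<open>\<tau>\<^sub>k\<close> for less than
  \<open>C\<^sub>k + U\<^sub>k (L - D\<^sub>k)\<close>. Summing up and dividing by \<open>L\<close> contradicts (i) or (ii).
\<close>

section \<open>Ranks in finite sets and measure on half-open windows\<close>

text \<open>Otherwise the least element of \<open>A\<close> outside the set has only members of the
  set below it, hence fewer than \<open>m\<close>, and so belongs to it. Applied to the active tasks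
  above a given one, this yields \<open>M\<close> executing tasks.\<close>

lemma card_first_elements:
  fixes A :: "nat set"
  assumes "finite A" "m \<le> card A"
  shows "m \<le> card {h \<in> A. card {h' \<in> A. h' < h} < m}"
proof (rule ccontr)
  define B where "B = {h \<in> A. card {h' \<in> A. h' < h} < m}"
  assume "\<not> ?thesis"
  then have lt: "card B < m" by (simp add: B_def)
  have fB: "finite B" "B \<subseteq> A" using assms(1) by (auto simp: B_def)
  then have ne: "A - B \<noteq> {}" using lt assms by (metis Diff_eq_empty_iff leD subset_antisym)
  define x where "x = Min (A - B)"
  have x: "x \<in> A - B" unfolding x_def using ne assms(1) by (intro Min_in) auto
  have "{h' \<in> A. h' < x} \<subseteq> B"
  proof
    fix h assume h: "h \<in> {h' \<in> A. h' < x}"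
    show "h \<in> B"
    proof (rule ccontr)
      assume "h \<notin> B"
      then have "x \<le> h" unfolding x_def using h assms(1) by (intro Min_le) auto
      then show False using h by simp
    qed
  qed
  then have "card {h' \<in> A. h' < x} < m"
    using lt fB card_mono by (meson le_less_trans)
  then show False using x by (simp add: B_def)
qed

lemma lmeasurable_Int_Ico [intro, simp]:
  fixes X :: "real set"
  assumes "X \<in> sets lebesgue"
  shows "X \<inter> {u..<v} \<in> lmeasurable"
proof -
  have "{u..<v} \<in> lmeasurable"
    by (rule bounded_set_imp_lmeasurable) auto
  then show ?thesis
    by (metis Int_commute assms fmeasurable_Int_fmeasurable)
qed

lemma measure_Int_Ico_le:
  fixes X :: "real set"
  assumes "X \<in> sets lebesgue" "u \<le> v"
  shows "measure lebesgue (X \<inter> {u..<v}) \<le> v - u"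
proof -
  have "{u..<v} \<in> lmeasurable"
    by (rule bounded_set_imp_lmeasurable) auto
  then have "measure lebesgue (X \<inter> {u..<v}) \<le> measure lebesgue {u..<v}"
    using assms by (intro measure_mono_fmeasurable) auto
  then show ?thesis using assms(2) by simp
qed

lemma measure_Int_Ico_split:
  fixes X :: "real set"
  assumes "X \<in> sets lebesgue" "u \<le> v" "v \<le> w"
  shows "measure lebesgue (X \<inter> {u..<w})
    = measure lebesgue (X \<inter> {u..<v}) + measure lebesgue (X \<inter> {v..<w})"
proof -
  have "X \<inter> {u..<w} = (X \<inter> {u..<v}) \<union> (X \<inter> {v..<w})" using assms by auto
  moreover have "(X \<inter> {u..<v}) \<inter> (X \<inter> {v..<w}) = {}" by auto
  moreover have "emeasure lebesgue (X \<inter> {s..<t}) \<noteq> \<infinity>" "X \<inter> {s..<t} \<in> sets lebesgue" for s t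
    using fmeasurableD2[OF lmeasurable_Int_Ico[OF assms(1)]] assms(1) by auto
  ultimately show ?thesis by (metis measure_Union)
qed

section \<open>A fixed run: execution times and service of jobs\<close>

locale global_fp_run =
  fixes M n :: nat and C T :: "nat \<Rightarrow> real" and a e :: "nat \<Rightarrow> nat \<Rightarrow> real" and \<sigma> :: schedule
  assumes T_pos: "i \<in> {1..n} \<Longrightarrow> 0 < T i"
    and arrivals: "legal_arrivals n T a"
    and demands: "legal_demands n C e"
    and sched: "global_fp_schedule M n a e \<sigma>"
begin

definition job_time :: "nat \<Rightarrow> nat \<Rightarrow> real set" where
  "job_time i j = {t. 0 \<le> t \<and> executes M \<sigma> i j t}"

definition task_time :: "nat \<Rightarrow> real set" where
  "task_time i = (\<Union>j. job_time i j)"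

text \<open>As a task holds at most one processor, the length of time during which it executes is
  the amount of execution it receives.\<close>

definition work :: "nat \<Rightarrow> real \<Rightarrow> real \<Rightarrow> real" where
  "work i u v = measure lebesgue (task_time i \<inter> {u..<v})"

lemma sets_job_time [simp, intro]: "job_time i j \<in> sets lebesgue"
  using sched by (simp add: global_fp_schedule_def job_time_def)

lemma sets_task_time [simp, intro]: "task_time i \<in> sets lebesgue"
  unfolding task_time_def by auto

lemma service_eq: "service M \<sigma> i j t = measure lebesgue (job_time i j \<inter> {0..<t})"
  unfolding service_def job_time_def by (rule arg_cong[where f = "measure lebesgue"]) auto

lemma work_split: "u \<le> v \<Longrightarrow> v \<le> w \<Longrightarrow> work i u w = work i u v + work i v w"
  unfolding work_def by (rule measure_Int_Ico_split[OF sets_task_time])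

lemma service_mono: "s \<le> t \<Longrightarrow> service M \<sigma> i j s \<le> service M \<sigma> i j t"
  unfolding service_eq by (intro measure_mono_fmeasurable) auto

lemma pending_if_job_time: "t \<in> job_time i j \<Longrightarrow> pending M a e \<sigma> i j t"
  using sched by (auto simp: global_fp_schedule_def job_time_def)

lemma no_earlier_pending_if_job_time:
  "t \<in> job_time i j \<Longrightarrow> j' < j \<Longrightarrow> \<not> pending M a e \<sigma> i j' t"
  using sched by (auto simp: global_fp_schedule_def job_time_def)

lemma executing_tasks:
  assumes "0 \<le> t"
  shows "{i. t \<in> task_time i} =
    {i \<in> active_tasks M n a e \<sigma> t. card {h \<in> active_tasks M n a e \<sigma> t. h < i} < M}"
  using sched assms by (simp add: global_fp_schedule_def task_time_def job_time_def)

text \<open>A job executes only while its service is below its demand. With an excess of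
  \<open>\<epsilon>\<close>, an execution instant \<open>s\<close> within
  \<open>\<epsilon> / 2\<close> of the supremum \<open>z\<close> would still see service below
  \<open>e i j\<close>, and less than \<open>\<epsilon>\<close> could follow.\<close>

lemma service_le_demand:
  assumes "0 \<le> e i j"
  shows "service M \<sigma> i j t \<le> e i j"
proof (rule ccontr)
  assume "\<not> ?thesis"
  then have gt: "e i j < service M \<sigma> i j t" by simp
  define X where "X = job_time i j \<inter> {0..<t}"
  have "X \<noteq> {}" using gt assms by (auto simp: service_eq X_def)
  have bdd: "bdd_above X" unfolding X_def by (rule bdd_aboveI[of _ t]) auto
  define z where "z = Sup X"
  define \<epsilon> where "\<epsilon> = service M \<sigma> i j t - e i j"
  have "z - \<epsilon> / 2 < z" using gt by (simp add: \<epsilon>_def)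
  then obtain s where s: "s \<in> X" "z - \<epsilon> / 2 < s"
    unfolding z_def using less_cSup_iff[OF \<open>X \<noteq> {}\<close> bdd] by auto
  have sz: "s \<le> z" unfolding z_def using s bdd by (intro cSup_upper) auto
  \<comment> \<open>The right end lies beyond \<open>z\<close> because the half-open window must
    contain \<open>z\<close>, which may belong to \<open>X\<close>.\<close>
  have "X \<subseteq> (job_time i j \<inter> {0..<s}) \<union> (job_time i j \<inter> {s..<z + \<epsilon> / 2})"
  proof
    fix x assume x: "x \<in> X"
    then have "x \<le> z" unfolding z_def using bdd by (rule cSup_upper)
    also have "z < z + \<epsilon> / 2" using gt by (simp add: \<epsilon>_def)
    finally show "x \<in> (job_time i j \<inter> {0..<s}) \<union> (job_time i j \<inter> {s..<z + \<epsilon> / 2})"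
      using x by (auto simp: X_def)
  qed
  then have "measure lebesgue X \<le>
      measure lebesgue ((job_time i j \<inter> {0..<s}) \<union> (job_time i j \<inter> {s..<z + \<epsilon> / 2}))"
    by (intro measure_mono_fmeasurable) (auto simp: X_def)
  also have "\<dots> \<le> service M \<sigma> i j s + measure lebesgue (job_time i j \<inter> {s..<z + \<epsilon> / 2})"
    unfolding service_eq by (intro measure_Un_le) auto
  also have "\<dots> \<le> service M \<sigma> i j s + (z + \<epsilon> / 2 - s)"
    using sz \<open>z - \<epsilon> / 2 < z\<close> by (intro add_left_mono measure_Int_Ico_le) auto
  also have "\<dots> < e i j + \<epsilon>"
    using pending_if_job_time[of s i j] s by (auto simp: X_def pending_def)
  finally show False by (simp add: X_def service_eq \<epsilon>_def)
qed

section \<open>Arrivals and busy windows\<close>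

lemma arrival_spread:
  assumes "i \<in> {1..n}"
  shows "a i m + real r * T i \<le> a i (m + r)"
proof (induction r)
  case (Suc r)
  have "a i (m + r) + T i \<le> a i (Suc (m + r))"
    using arrivals assms by (auto simp: legal_arrivals_def)
  with Suc show ?case by (simp add: algebra_simps)
qed simp

lemma arrival_nonneg: "i \<in> {1..n} \<Longrightarrow> 0 \<le> a i m"
  using arrivals by (auto simp: legal_arrivals_def)

lemma arrival_strict_mono:
  assumes "i \<in> {1..n}" "m < m'"
  shows "a i m < a i m'"
proof -
  have "0 < real (m' - m) * T i" using T_pos assms by simp
  then show ?thesis using arrival_spread[OF assms(1), of m "m' - m"] assms(2) by simp
qed

lemma arrival_mono: "i \<in> {1..n} \<Longrightarrow> m \<le> m' \<Longrightarrow> a i m \<le> a i m'"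
  using arrival_strict_mono[of i m m'] by (cases "m = m'") auto

lemma finite_arrivals_le:
  assumes "i \<in> {1..n}"
  shows "finite {m. a i m \<le> t}"
proof (rule finite_subset)
  show "{m. a i m \<le> t} \<subseteq> {..nat \<lceil>t / T i\<rceil>}"
  proof
    fix m assume "m \<in> {m. a i m \<le> t}"
    then have "real m * T i \<le> t"
      using arrival_spread[OF assms, of 0 m] arrival_nonneg[OF assms, of 0] by simp
    then have "real m \<le> t / T i" using T_pos[OF assms] by (simp add: field_simps)
    then show "m \<in> {..nat \<lceil>t / T i\<rceil>}" by simp linarith
  qed
qed simp

text \<open>Take the last arrival before \<open>t\<close> at which all earlier jobs are finished. If
  the task is inactive at some \<open>s\<close> between that arrival and \<open>t\<close>, all jobs
  arrived by \<open>s\<close> are finished; the first arrival after \<open>s\<close> would then be a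
  later choice unless it is at \<open>t\<close> or after, in which case nothing is carried into
  \<open>t\<close>.\<close>

lemma busy_window_start:
  assumes i: "i \<in> {1..n}"
  obtains (idle) m where "t \<le> a i m" "\<forall>j<m. e i j \<le> service M \<sigma> i j t"
  | (busy) m where "a i m < t" "\<forall>j<m. e i j \<le> service M \<sigma> i j (a i m)"
      "\<forall>s\<in>{a i m..<t}. i \<in> active_tasks M n a e \<sigma> s"
proof (cases "a i 0 < t")
  case False
  then show ?thesis using idle[of 0] by simp
next
  case True
  define P where "P m \<longleftrightarrow> a i m < t \<and> (\<forall>j<m. e i j \<le> service M \<sigma> i j (a i m))" for m
  have fin: "finite {m. P m}"
    by (rule finite_subset[OF _ finite_arrivals_le[OF i, of t]]) (auto simp: P_def)
  have "{m. P m} \<noteq> {}" using True by (auto simp: P_def intro!: exI[of _ 0])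
  define m where "m = Max {m. P m}"
  have Pm: "P m" using Max_in[OF fin \<open>{m. P m} \<noteq> {}\<close>] by (simp add: m_def)
  have max: "m' \<le> m" if "P m'" for m' using Max_ge[OF fin] that by (simp add: m_def)
  show ?thesis
  proof (cases "\<forall>s\<in>{a i m..<t}. i \<in> active_tasks M n a e \<sigma> s")
    case True
    then show ?thesis using busy Pm by (auto simp: P_def)
  next
    case False
    then obtain s where s: "a i m \<le> s" "s < t" "i \<notin> active_tasks M n a e \<sigma> s" by auto
    have all_done: "e i j \<le> service M \<sigma> i j s" if "a i j \<le> s" for j
      using s(3) i that by (auto simp: active_tasks_def pending_def not_less)
    have "\<exists>m'. s < a i m'"
    proof (rule ccontr)
      assume "\<not> ?thesis"
      then have "{m. a i m \<le> s} = UNIV" by (auto simp: not_less)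
      then show False using finite_arrivals_le[OF i, of s] by simp
    qed
    define m' where "m' = (LEAST m'. s < a i m')"
    have m': "s < a i m'" unfolding m'_def by (rule LeastI_ex) fact
    have before: "e i j \<le> service M \<sigma> i j s" if "j < m'" for j
      using all_done[of j] not_less_Least[of j "\<lambda>m'. s < a i m'"] that by (auto simp: m'_def)
    have "m < m'" using s(1) m' arrival_mono[OF i, of m' m] by (meson leD le_less_trans not_le)
    then have "\<not> P m'" using max by (meson leD)
    moreover have "\<forall>j<m'. e i j \<le> service M \<sigma> i j (a i m')"
      using before service_mono m' by (meson less_imp_le order_trans)
    ultimately have "t \<le> a i m'" by (auto simp: P_def)
    then show ?thesis
      using idle[of m'] before service_mono s(2) by (meson less_imp_le order_trans)
  qed
qed

section \<open>Upper bounds on the work of one task\<close>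

lemma job_time_not_finished:
  assumes "t \<in> job_time i j" "e i j \<le> service M \<sigma> i j u" "u \<le> t"
  shows False
  using pending_if_job_time[OF assms(1)] assms(2) service_mono[OF assms(3), of i j]
  by (auto simp: pending_def)

text \<open>With nothing carried in, only the jobs \<open>m\<close> to \<open>m + q\<close> can run
  in a window containing \<open>q\<close> whole periods: the first \<open>q\<close> take at most
  \<open>C i\<close> each, the last at most \<open>min (C i) r\<close>, where \<open>r\<close> is
  what remains of the window after \<open>q\<close> periods.\<close>

lemma work_le:
  assumes i: "i \<in> {1..n}" and util: "C i \<le> T i" and "u \<le> v"
    and start: "u \<le> a i m" and fin: "\<forall>j<m. e i j \<le> service M \<sigma> i j u"
  shows "work i u v \<le> C i - C i * (C i / T i) + C i / T i * (v - u)"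
proof -
  have T: "0 < T i" using T_pos i by simp
  define q where "q = nat \<lfloor>(v - u) / T i\<rfloor>"
  have "real q \<le> (v - u) / T i" "(v - u) / T i < real q + 1"
    using T \<open>u \<le> v\<close> by (auto simp: q_def)
  then have q: "real q * T i \<le> v - u" "v - u < (real q + 1) * T i"
    using T by (auto simp: field_simps)
  have e: "0 \<le> e i j" "e i j \<le> C i" for j using demands i by (auto simp: legal_demands_def)
  then have C: "0 \<le> C i" by (meson order_trans)
  let ?full = "\<Union>j\<in>{m..<m + q}. job_time i j \<inter> {0..<v}"
  let ?last = "job_time i (m + q) \<inter> {u + real q * T i..<v}"
  have arr: "u + real r * T i \<le> a i (m + r)" for r
    using arrival_spread[OF i, of m r] start by simp
  have "task_time i \<inter> {u..<v} \<subseteq> ?full \<union> ?last"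
  proof
    fix s assume s: "s \<in> task_time i \<inter> {u..<v}"
    then obtain j where j: "s \<in> job_time i j" by (auto simp: task_time_def)
    have "m \<le> j" using job_time_not_finished[OF j] fin s by (meson IntD2 atLeastLessThan_iff not_le)
    then obtain r where r: "j = m + r" using le_Suc_ex by blast
    have "a i j \<le> s" using pending_if_job_time[OF j] by (simp add: pending_def)
    then have ar: "u + real r * T i \<le> s" using arr[of r] r by simp
    have "real r * T i < (real q + 1) * T i" using ar s q by auto
    then have "real r < real q + 1" using T by (simp add: mult_less_cancel_right)
    then have "r \<le> q" by linarith
    moreover have "0 \<le> s" using j by (simp add: job_time_def)
    ultimately show "s \<in> ?full \<union> ?last" using j r ar s by (cases "r = q") auto
  qed
  then have "work i u v \<le> measure lebesgue (?full \<union> ?last)"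
    unfolding work_def by (intro measure_mono_fmeasurable) (auto intro!: fmeasurable.Un fmeasurable.finite_UN)
  also have "\<dots> \<le> measure lebesgue ?full + measure lebesgue ?last"
    by (intro measure_Un_le sets.finite_UN) auto
  also have "measure lebesgue ?full \<le> (\<Sum>j\<in>{m..<m + q}. service M \<sigma> i j v)"
    unfolding service_eq by (intro measure_UNION_le) auto
  also have "\<dots> \<le> (\<Sum>j\<in>{m..<m + q}. C i)"
    using service_le_demand e by (intro sum_mono) (meson order_trans)
  finally have bound: "work i u v \<le> real q * C i + measure lebesgue ?last" by simp
  have "measure lebesgue ?last \<le> service M \<sigma> i (m + q) v"
    unfolding service_eq
  proof (intro measure_mono_fmeasurable)
    show "?last \<subseteq> job_time i (m + q) \<inter> {0..<v}" by (auto simp: job_time_def)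
  qed auto
  also have "\<dots> \<le> C i" using service_le_demand e by (meson order_trans)
  finally have last1: "measure lebesgue ?last \<le> C i" .
  define r where "r = v - u - real q * T i"
  have last2: "measure lebesgue ?last \<le> r"
    using measure_Int_Ico_le[of "job_time i (m + q)" "u + real q * T i" v] q by (simp add: r_def)
  define U where "U = C i / T i"
  have U: "0 \<le> U" "U \<le> 1" using C T util by (auto simp: U_def)
  \<comment> \<open>As \<open>0 \<le> U \<le> 1\<close>, the function
    \<open>min (C i) r - U * r\<close> of \<open>r\<close> attains its maximum at
    \<open>r = C i\<close>.\<close>
  have "measure lebesgue ?last - U * r \<le> C i - C i * U"
  proof (cases "r \<le> C i")
    case True
    have "(1 - U) * r \<le> (1 - U) * C i" using True U by (intro mult_left_mono) auto
    then show ?thesis using last2 by (simp add: algebra_simps)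
  next
    case False
    then have "U * C i \<le> U * r" using U by (intro mult_left_mono) auto
    then show ?thesis using last1 by (simp add: algebra_simps)
  qed
  moreover have "real q * C i = U * (v - u) - U * r"
    using T by (simp add: U_def r_def field_simps)
  ultimately show ?thesis using bound unfolding U_def by (simp add: mult.commute)
qed

text \<open>Jobs of a task run in order, so while job \<open>j\<close> is unfinished only the jobs
  \<open>m\<close> to \<open>j\<close> can run after \<open>u\<close>. Job \<open>j\<close> falls
  short of its demand, which makes the bound strict; the final contradiction rests on this
  strictness.\<close>

lemma work_less_until_miss:
  assumes i: "i \<in> {1..n}" and miss: "service M \<sigma> i j d < e i j"
    and start: "u \<le> a i m" "u \<le> d" and fin: "\<forall>j'<m. e i j' \<le> service M \<sigma> i j' u"
  shows "m \<le> j" "work i u d < (real (j - m) + 1) * C i"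
proof -
  have e: "0 \<le> e i j" "e i j \<le> C i" for j using demands i by (auto simp: legal_demands_def)
  show mj: "m \<le> j"
    using fin miss service_mono[OF \<open>u \<le> d\<close>, of i j] by (meson leD le_less_trans not_le)
  have "task_time i \<inter> {u..<d} \<subseteq> (\<Union>r\<in>{m..j}. job_time i r \<inter> {0..<d})"
  proof
    fix s assume s: "s \<in> task_time i \<inter> {u..<d}"
    then obtain r where r: "s \<in> job_time i r" by (auto simp: task_time_def)
    have "m \<le> r" using job_time_not_finished[OF r] fin s by (meson IntD2 atLeastLessThan_iff not_le)
    moreover have "r \<le> j"
    proof (rule ccontr)
      assume "\<not> r \<le> j"
      then have jr: "j < r" by simp
      have "a i j \<le> s"
        using pending_if_job_time[OF r] arrival_mono[OF i, of j r] jr by (simp add: pending_def)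
      moreover have "service M \<sigma> i j s < e i j"
        using miss service_mono[of s d i j] s by auto
      ultimately show False
        using no_earlier_pending_if_job_time[OF r jr] by (simp add: pending_def)
    qed
    moreover have "0 \<le> s" using r by (simp add: job_time_def)
    ultimately show "s \<in> (\<Union>r\<in>{m..j}. job_time i r \<inter> {0..<d})" using r s by auto
  qed
  then have "work i u d \<le> measure lebesgue (\<Union>r\<in>{m..j}. job_time i r \<inter> {0..<d})"
    unfolding work_def by (intro measure_mono_fmeasurable) (auto intro!: fmeasurable.finite_UN)
  also have "\<dots> \<le> (\<Sum>r\<in>{m..j}. service M \<sigma> i r d)"
    unfolding service_eq by (intro measure_UNION_le) auto
  also have "\<dots> < (\<Sum>r\<in>{m..j}. C i)"
  proof (rule sum_strict_mono_ex1)
    show "\<forall>r\<in>{m..j}. service M \<sigma> i r d \<le> C i" using service_le_demand e by (meson order_trans)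
    show "\<exists>r\<in>{m..j}. service M \<sigma> i r d < C i"
      using mj miss e(2)[of j] by (intro bexI[of _ j]) auto
  qed simp
  finally show "work i u d < (real (j - m) + 1) * C i"
    using mj by (simp add: of_nat_diff Suc_diff_le algebra_simps)
qed

section \<open>Lower bounds on the total work\<close>

text \<open>An active task is denied a processor only if at least \<open>M\<close> active tasks
  precede it, and the first \<open>M\<close> of these execute.\<close>

lemma card_executing_ge:
  assumes "0 \<le> t" and active: "i \<in> active_tasks M n a e \<sigma> t" and ik: "i \<le> k"
    and "t \<notin> task_time i"
  shows "M \<le> card {h \<in> {1..k}. t \<in> task_time h}"
proof -
  let ?A = "active_tasks M n a e \<sigma> t"
  let ?B = "{h \<in> ?A. h < i}"
  have fin: "finite ?A" by (simp add: active_tasks_def)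
  have "i \<notin> {i. t \<in> task_time i}" using assms(4) by simp
  then have "M \<le> card ?B" unfolding executing_tasks[OF assms(1)] using active by simp
  then have "M \<le> card {h \<in> ?B. card {h' \<in> ?B. h' < h} < M}"
    using fin by (intro card_first_elements) auto
  also have "\<dots> \<le> card {h \<in> {1..k}. t \<in> task_time h}"
  proof (rule card_mono)
    show "{h \<in> ?B. card {h' \<in> ?B. h' < h} < M} \<subseteq> {h \<in> {1..k}. t \<in> task_time h}"
    proof
      fix h assume h: "h \<in> {h \<in> ?B. card {h' \<in> ?B. h' < h} < M}"
      \<comment> \<open>Since \<open>h < i\<close>, the restriction to tasks before \<open>i\<close>
        leaves the rank of \<open>h\<close> unchanged.\<close>
      then have "{h' \<in> ?B. h' < h} = {h' \<in> ?A. h' < h}" by auto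
      then have "h \<in> {h \<in> ?A. card {h' \<in> ?A. h' < h} < M}" using h by auto
      then have "t \<in> task_time h" using executing_tasks[OF assms(1)] by blast
      moreover have "1 \<le> h" using h by (auto simp: active_tasks_def)
      ultimately show "h \<in> {h \<in> {1..k}. t \<in> task_time h}" using h ik by auto
    qed
  qed simp
  finally show ?thesis .
qed

text \<open>At each instant of the window at least \<open>M\<close> of the tasks up to
  \<open>k\<close> execute if \<open>i\<close> does not, and at least one, \<open>i\<close> itself,
  if it does. Counting \<open>i\<close> with \<open>M - 1\<close> extra units gives at least
  \<open>M\<close> in both cases; this is integrated over the window.\<close>

lemma work_ge_while_active:
  assumes "1 \<le> M" "0 \<le> u" "u \<le> v" and i: "i \<in> {1..k}"
    and active: "\<forall>s\<in>{u..<v}. i \<in> active_tasks M n a e \<sigma> s"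
  shows "real M * (v - u) - (real M - 1) * work i u v \<le> (\<Sum>h\<in>{1..k}. work h u v)"
proof -
  let ?f = "\<lambda>h s. indicator (task_time h \<inter> {u..<v}) s :: real"
  have int: "integrable lebesgue (?f h)" for h
    using lmeasurable_Int_Ico[OF sets_task_time, of h u v] by (auto simp: fmeasurable_def)
  have val: "integral\<^sup>L lebesgue (?f h) = work h u v" for h
    by (simp add: work_def)
  have ico: "{u..<v} \<in> lmeasurable" by (rule bounded_set_imp_lmeasurable) auto
  have "integral\<^sup>L lebesgue (\<lambda>s. real M * indicator {u..<v} s)
      \<le> integral\<^sup>L lebesgue (\<lambda>s. (\<Sum>h\<in>{1..k}. ?f h s) + (real M - 1) * ?f i s)"
  proof (rule integral_mono)
    show "integrable lebesgue (\<lambda>s. real M * indicator {u..<v} s)"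
      using ico by (auto simp: fmeasurable_def)
    show "integrable lebesgue (\<lambda>s. (\<Sum>h\<in>{1..k}. ?f h s) + (real M - 1) * ?f i s)"
      using int by (intro Bochner_Integration.integrable_add Bochner_Integration.integrable_sum
          integrable_mult_right) auto
    fix s :: real
    show "real M * indicator {u..<v} s \<le> (\<Sum>h\<in>{1..k}. ?f h s) + (real M - 1) * ?f i s"
    proof (cases "s \<in> {u..<v}")
      case s: True
      have sum: "(\<Sum>h\<in>{1..k}. ?f h s) = real (card {h \<in> {1..k}. s \<in> task_time h})"
        using s by (simp add: indicator_def sum.If_cases Int_def)
      show ?thesis
      proof (cases "s \<in> task_time i")
        case True
        then have "card {i} \<le> card {h \<in> {1..k}. s \<in> task_time h}"
          using i by (intro card_mono) auto
        then show ?thesis using s True sum by simp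
      next
        case False
        then show ?thesis
          using card_executing_ge[of s i k] s active i assms(2) sum by simp
      qed
    qed simp
  qed
  also have "\<dots> = (\<Sum>h\<in>{1..k}. work h u v) + (real M - 1) * work i u v"
    using int val by simp
  finally show ?thesis using \<open>u \<le> v\<close> ico by (simp add: fmeasurable_def)
qed

section \<open>The window ending at a missed deadline\<close>

text \<open>\<open>L\<close> is the length of the window \<open>[t\<^sub>0, d)\<close>.\<close>

lemma work_bounds_at_miss:
  assumes M: "1 \<le> M" and k: "k \<in> {1..n}" and D: "T k \<le> D"
    and C: "\<forall>i\<in>{1..k}. 0 \<le> C i \<and> C i \<le> T i"
    and \<rho>: "\<forall>i\<in>{1..k}. C i / T i \<le> \<rho>"
    and miss: "service M \<sigma> k j (a k j + D) < e k j"
  obtains L where "D \<le> L"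
    "(real M - (real M - 1) * \<rho>) * L
      < C k + C k / T k * (L - D) + (\<Sum>i\<in>{1..<k}. C i - C i * (C i / T i) + C i / T i * L)"
proof -
  define d where "d = a k j + D"
  define \<mu> where "\<mu> = real M - (real M - 1) * \<rho>"
  define W where "W u v = (\<Sum>h\<in>{1..k}. work h u v)" for u v
  have Tk: "0 < T k" using T_pos k by simp
  have jd: "a k j < d" using Tk D by (simp add: d_def)
  have tasks: "i \<in> {1..n}" if "i \<in> {1..k}" for i using that k by auto
  have W_split: "W u w = W u v + W v w" if "u \<le> v" "v \<le> w" for u v w
    unfolding W_def sum.distrib[symmetric] using that by (intro sum.cong refl work_split)
  \<comment> \<open>Job \<open>j\<close> arrives at \<open>d - D\<close>, at least
    \<open>j - m\<close> periods after \<open>u\<close>; this turns the number of jobs into a bound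
    linear in the window length.\<close>
  have miss_bound: "work k u d < C k + C k / T k * (d - u - D)" "m \<le> j"
    if "u \<le> a k m" "u \<le> d" "\<forall>j'<m. e k j' \<le> service M \<sigma> k j' u" for u m
  proof -
    have less: "m \<le> j" "work k u d < (real (j - m) + 1) * C k"
      using work_less_until_miss[OF k, of j d u m] miss jd that by (auto simp: d_def)
    then show "m \<le> j" by simp
    have "u + real (j - m) * T k \<le> a k j"
      using arrival_spread[OF k, of m "j - m"] less(1) that(1) by simp
    then have "real (j - m) \<le> (d - u - D) / T k"
      using Tk by (simp add: d_def field_simps)
    then have "C k * real (j - m) \<le> C k * ((d - u - D) / T k)"
      using C k by (intro mult_left_mono) auto
    then show "work k u d < C k + C k / T k * (d - u - D)"
      using less(2) by (simp add: algebra_simps)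
  qed
  \<comment> \<open>The first candidate for \<open>t\<^sub>0\<close> is the start of the busy window
    of task \<open>k\<close>; the idle case is impossible because job \<open>j\<close> is unfinished
    at \<open>d\<close>.\<close>
  obtain m\<^sub>1 where m\<^sub>1: "a k m\<^sub>1 \<le> a k j" "\<mu> * (d - a k m\<^sub>1) \<le> W (a k m\<^sub>1) d"
  proof (cases rule: busy_window_start[OF k, where t = d, case_names idle busy])
    case (idle m)
    then have "j < m" using jd arrival_mono[OF k, of m j] by (meson leD le_less_trans not_le)
    then show thesis using idle miss unfolding d_def[symmetric] by (meson leD)
  next
    case (busy m)
    let ?u = "a k m"
    have b: "work k ?u d < C k + C k / T k * (d - ?u - D)" "m \<le> j"
      using miss_bound[of ?u m] busy by auto
    \<comment> \<open>From \<open>T k \<le> D\<close>, the constant \<open>C k\<close> is absorbed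
      by \<open>C k / T k * D\<close>, so task \<open>k\<close> executes at a rate of at most
      \<open>\<rho>\<close>.\<close>
    have "C k + C k / T k * (d - ?u - D) \<le> C k / T k * (d - ?u)"
    proof -
      have "C k / T k * T k \<le> C k / T k * D" using C k D Tk by (intro mult_left_mono) auto
      moreover have "C k / T k * T k = C k" using Tk by simp
      ultimately show ?thesis unfolding right_diff_distrib by linarith
    qed
    also have "\<dots> \<le> \<rho> * (d - ?u)" using \<rho> k busy(1) by (intro mult_right_mono) auto
    finally have "work k ?u d \<le> \<rho> * (d - ?u)" using b by simp
    then have "(real M - 1) * work k ?u d \<le> (real M - 1) * (\<rho> * (d - ?u))"
      using M by (intro mult_left_mono) auto
    moreover have "real M * (d - ?u) - (real M - 1) * work k ?u d \<le> W ?u d"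
      unfolding W_def using M k busy arrival_nonneg[OF k] by (intro work_ge_while_active) auto
    ultimately have "\<mu> * (d - ?u) \<le> W ?u d" by (simp add: \<mu>_def algebra_simps)
    then show thesis using that b(2) arrival_mono[OF k] by blast
  qed
  text \<open>
    Restricting the choice of \<open>t\<^sub>0\<close> to arrivals loses nothing, since busy windows start at
    arrivals, and makes the set of candidates finite.
  \<close>
  define A where "A = (\<Union>i\<in>{1..k}. a i ` {m. a i m \<le> a k m\<^sub>1})"
  define S where "S = {t \<in> A. \<mu> * (d - t) \<le> W t d}"
  have "finite A" unfolding A_def using finite_arrivals_le tasks by blast
  then have finS: "finite S" by (simp add: S_def)
  have "a k m\<^sub>1 \<in> S" using m\<^sub>1 k by (auto simp: S_def A_def)
  define t\<^sub>0 where "t\<^sub>0 = Min S"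
  have t\<^sub>0: "t\<^sub>0 \<in> S" unfolding t\<^sub>0_def using finS \<open>a k m\<^sub>1 \<in> S\<close> by (intro Min_in) auto
  have t\<^sub>0_le: "t\<^sub>0 \<le> a k m\<^sub>1" unfolding t\<^sub>0_def using finS \<open>a k m\<^sub>1 \<in> S\<close> by (rule Min_le)
  have t\<^sub>0_d: "t\<^sub>0 < d" using t\<^sub>0_le m\<^sub>1(1) jd by simp
  have carry: "C i / T i * (t\<^sub>0 - a i m) < work i (a i m) t\<^sub>0"
    if i: "i \<in> {1..k}" and lt: "a i m < t\<^sub>0"
      and active: "\<forall>s\<in>{a i m..<t\<^sub>0}. i \<in> active_tasks M n a e \<sigma> s" for i m
  proof -
    let ?u = "a i m"
    \<comment> \<open>An arrival before the minimum \<open>t\<^sub>0\<close> violates the rate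
      condition up to \<open>d\<close>, while \<open>t\<^sub>0\<close> satisfies it, so the deficit
      lies before \<open>t\<^sub>0\<close>.\<close>
    have "?u \<notin> S" using Min_le[OF finS, of ?u] lt unfolding t\<^sub>0_def by auto
    moreover have "?u \<in> A" unfolding A_def using i lt t\<^sub>0_le by (intro UN_I[of i] imageI) auto
    ultimately have "W ?u d < \<mu> * (d - ?u)" by (simp add: S_def)
    moreover have "W ?u d = W ?u t\<^sub>0 + W t\<^sub>0 d" using lt t\<^sub>0_d by (intro W_split) auto
    moreover have "\<mu> * (d - t\<^sub>0) \<le> W t\<^sub>0 d" using t\<^sub>0 by (simp add: S_def)
    ultimately have "W ?u t\<^sub>0 < \<mu> * (t\<^sub>0 - ?u)" by (simp add: algebra_simps)
    moreover have "real M * (t\<^sub>0 - ?u) - (real M - 1) * work i ?u t\<^sub>0 \<le> W ?u t\<^sub>0"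
      unfolding W_def using M i lt active arrival_nonneg[OF tasks[OF i]]
      by (intro work_ge_while_active) auto
    ultimately have "(real M - 1) * (\<rho> * (t\<^sub>0 - ?u)) < (real M - 1) * work i ?u t\<^sub>0"
      by (simp add: \<mu>_def algebra_simps)
    \<comment> \<open>For \<open>M = 1\<close> the strict inequality would read
      \<open>0 < 0\<close>, so the factor is positive and cancels.\<close>
    then have "\<rho> * (t\<^sub>0 - ?u) < work i ?u t\<^sub>0"
      using M by (simp add: mult_less_cancel_left)
    moreover have "C i / T i * (t\<^sub>0 - ?u) \<le> \<rho> * (t\<^sub>0 - ?u)"
      using \<rho> i lt by (intro mult_right_mono) auto
    ultimately show ?thesis by simp
  qed
  have higher: "work i t\<^sub>0 d \<le> C i - C i * (C i / T i) + C i / T i * (d - t\<^sub>0)"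
    if i: "i \<in> {1..k}" for i
  proof (cases rule: busy_window_start[OF tasks[OF i], where t = t\<^sub>0, case_names idle busy])
    case (idle m)
    then show ?thesis using C i t\<^sub>0_d tasks by (intro work_le) auto
  next
    case (busy m)
    \<comment> \<open>The bound is taken from the start of the busy window; its extra term
      \<open>C i / T i * (t\<^sub>0 - a i m)\<close> is outweighed by the work done before
      \<open>t\<^sub>0\<close>.\<close>
    have "work i (a i m) d \<le> C i - C i * (C i / T i) + C i / T i * (d - a i m)"
      using busy C i t\<^sub>0_d tasks by (intro work_le[where m = m]) auto
    moreover have "work i (a i m) d = work i (a i m) t\<^sub>0 + work i t\<^sub>0 d"
      using busy t\<^sub>0_d by (intro work_split) auto
    ultimately show ?thesis
      using carry[OF i busy(1,3)] unfolding right_diff_distrib by linarith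
  qed
  \<comment> \<open>The same subtraction, now from \<open>miss_bound\<close>, which counts only jobs
    up to \<open>j\<close> and is strict.\<close>
  have own: "work k t\<^sub>0 d < C k + C k / T k * (d - t\<^sub>0 - D)"
  proof (cases rule: busy_window_start[OF k, where t = t\<^sub>0, case_names idle busy])
    case (idle m)
    then show ?thesis using miss_bound t\<^sub>0_d by auto
  next
    case (busy m)
    have "work k (a k m) d < C k + C k / T k * (d - a k m - D)"
      using busy t\<^sub>0_d by (intro miss_bound) auto
    moreover have "work k (a k m) d = work k (a k m) t\<^sub>0 + work k t\<^sub>0 d"
      using busy t\<^sub>0_d by (intro work_split) auto
    moreover have "C k / T k * (t\<^sub>0 - a k m) < work k (a k m) t\<^sub>0"
      using carry k busy(1,3) by simp
    ultimately show ?thesis unfolding right_diff_distrib by linarith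
  qed
  have "{1..k} = insert k {1..<k}" using k by auto
  then have "W t\<^sub>0 d = work k t\<^sub>0 d + (\<Sum>i\<in>{1..<k}. work i t\<^sub>0 d)" by (simp add: W_def)
  moreover have "(\<Sum>i\<in>{1..<k}. work i t\<^sub>0 d)
      \<le> (\<Sum>i\<in>{1..<k}. C i - C i * (C i / T i) + C i / T i * (d - t\<^sub>0))"
    by (intro sum_mono higher) auto
  moreover have "\<mu> * (d - t\<^sub>0) \<le> W t\<^sub>0 d" using t\<^sub>0 by (simp add: S_def)
  moreover have "D \<le> d - t\<^sub>0" using t\<^sub>0_le m\<^sub>1(1) by (simp add: d_def)
  ultimately show thesis using that[of "d - t\<^sub>0"] own by (simp add: \<mu>_def)
qed

end

section \<open>The two cases of the schedulability test\<close>

theorem theorem4p6: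
  fixes M n k :: nat and C T D U :: "nat \<Rightarrow> real" and b :: real
  assumes "2 \<le> M"
    and "sporadic_task_set n C T D"
    and "1 \<le> k" and "k \<le> n"
    and "\<forall>i\<in>{1..<k}. schedulable M n C T D i"
    and "T k < D k"
    and "b = (D k - T k) / T k"
    and "U = utilization C T"
    and "b * U k - (\<Sum>i\<in>{1..<k}. (C i - C i * U i) / T k) > 0 \<longrightarrow>
           (\<Sum>i\<in>{1..k}. U i) \<le> real M - (real M - 1) * max_util_density C T D k"
    and "\<not> (b * U k - (\<Sum>i\<in>{1..<k}. (C i - C i * U i) / T k) > 0) \<longrightarrow>
           C k / D k + (\<Sum>i\<in>{1..<k}. ((C i - C i * U i) / D k + U i))
             \<le> real M - (real M - 1) * max_util_density C T D k"
  shows "schedulable M n C T D k"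
  unfolding schedulable_def
proof (intro allI impI, rule ccontr)
  fix a e \<sigma> j
  assume run: "legal_arrivals n T a \<and> legal_demands n C e \<and> global_fp_schedule M n a e \<sigma>"
    and "\<not> e k j \<le> service M \<sigma> k j (a k j + D k)"
  then have miss: "service M \<sigma> k j (a k j + D k) < e k j" by simp
  have task: "0 < C i" "0 < T i" "0 < D i" "C i / T i \<le> 1" if "i \<in> {1..n}" for i
    using assms(2) that unfolding sporadic_task_set_def utilization_def by blast+
  interpret global_fp_run M n C T a e \<sigma>
    using run task by unfold_locales auto
  define \<rho> where "\<rho> = max_util_density C T D k"
  define \<mu> where "\<mu> = real M - (real M - 1) * \<rho>"
  define s where "s = (\<Sum>i\<in>{1..<k}. C i - C i * U i)"
  define u where "u = (\<Sum>i\<in>{1..<k}. U i)"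
  have k: "k \<in> {1..n}" using assms by simp
  have U: "C i / T i = U i" for i by (simp add: assms(8) utilization_def)
  have "\<forall>i\<in>{1..k}. C i / T i \<le> \<rho>"
  proof
    fix i assume "i \<in> {1..k}"
    \<comment> \<open>As \<open>T k < D k\<close>, the density of task \<open>k\<close> equals its
      utilization, so \<open>\<rho>\<close> bounds that as well.\<close>
    moreover have "density C T D k = C k / T k" using assms(6) by (simp add: density_def)
    ultimately have "C i / T i \<in> insert (density C T D k) (utilization C T ` {1..<k})"
      by (cases "i = k") (auto simp: utilization_def)
    then show "C i / T i \<le> \<rho>" unfolding \<rho>_def max_util_density_def by (intro Max_ge) auto
  qed
  moreover have "\<forall>i\<in>{1..k}. 0 \<le> C i \<and> C i \<le> T i"
    using task k by (auto simp: less_imp_le pos_divide_le_eq)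
  ultimately obtain L where L: "D k \<le> L"
    "\<mu> * L < C k + U k * (L - D k) + (\<Sum>i\<in>{1..<k}. C i - C i * U i + U i * L)"
    using work_bounds_at_miss[of k "D k" \<rho> j] assms(1,6) k miss unfolding U \<mu>_def by auto
  have pos: "0 < T k" "0 < D k" "0 < L" using task k L(1) by (auto intro: less_le_trans)
  \<comment> \<open>\<open>N\<close> collects the part of the work bound that does not grow with
    \<open>L\<close>. Up to the factor \<open>- 1 / T k\<close> it is the quantity whose sign
    separates (i) from (ii).\<close>
  define N where "N = C k - U k * D k + s"
  have "(\<Sum>i\<in>{1..<k}. C i - C i * U i + U i * L) = s + u * L"
    by (simp add: s_def u_def sum.distrib sum_distrib_right)
  then have main: "\<mu> * L < (U k + u) * L + N"
    using L(2) by (simp add: N_def algebra_simps)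
  have "b * U k - (\<Sum>i\<in>{1..<k}. (C i - C i * U i) / T k) = - N / T k"
    using pos(1) by (simp add: N_def s_def assms(7) U[symmetric] sum_divide_distrib[symmetric] field_simps)
  then have cond: "b * U k - (\<Sum>i\<in>{1..<k}. (C i - C i * U i) / T k) > 0 \<longleftrightarrow> N < 0"
    using pos(1) by (simp add: divide_less_0_iff)
  show False
  proof (cases "N < 0")
    case True
    have "{1..k} = insert k {1..<k}" using k by auto
    then have "U k + u \<le> \<mu>" using assms(9) True cond by (simp add: u_def \<mu>_def \<rho>_def)
    then have "(U k + u) * L \<le> \<mu> * L" using pos by (intro mult_right_mono) auto
    then show False using main True by simp
  next
    case False
    have "C k / D k + s / D k + u \<le> \<mu>"
      using assms(10) False cond
      by (simp add: u_def s_def \<mu>_def \<rho>_def sum.distrib sum_divide_distrib)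
    moreover have "C k / D k + s / D k + u = U k + u + N / D k"
      using pos by (simp add: N_def field_simps)
    ultimately have "(U k + u + N / D k) * L \<le> \<mu> * L" using pos by (intro mult_right_mono) auto
    \<comment> \<open>For \<open>N \<ge> 0\<close> the ratio \<open>N / L\<close> is largest at the
      shortest possible window, \<open>L = D k\<close>; for \<open>N < 0\<close> it could simply be
      bounded by \<open>0\<close>.\<close>
    moreover have "N / D k * D k \<le> N / D k * L"
      using False L(1) pos by (intro mult_left_mono) auto
    then have "N \<le> N / D k * L" using pos by simp
    ultimately show False using main by (simp add: algebra_simps)
  qed
qed

end
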